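(* Let $l_s(\xi)$, $s=1,2,3$, where $\xi=\sum_{s=1}^3\alpha_s x_s$, be a solution of Lamé's system (with Guichard condition). Suppose that only one of the functions $l_s$ is constant. Then one of the following occurs: a) $l_1=\lambda_1$, $l_2=\lambda_1\cosh(b\xi+\xi_0)$, $l_3=\lambda_1\sinh(b\xi+\xi_0)$, where $\xi=\alpha_2x_2+\alpha_3x_3$, $\alpha_2^2+\alpha_3^2\neq0$ and $b,\xi_0\in\mathbb{R}$; b) $l_2=\lambda_2$, $l_1=\lambda_2\cos\varphi(\xi)$, $l_3=\lambda_2\sin\varphi(\xi)$, where $\xi=\alpha_1x_1+\alpha_3x_3$, $\alpha_1^2+\alpha_3^2\neq0$ and $\varphi$ is one of the following: b.1) $\varphi(\xi)=b\xi+\xi_0$, if $\alpha_1^2\neq\alpha_3^2$, where $\xi_0,b\in\mathbb{R}$; b.2) $\varphi$ is any function of $\xi$, if $\alpha_1^2=\alpha_3^2$; c) $l_3=\lambda_3$, $l_2=\lambda_3\cosh(b\xi+\xi_0)$, $l_1=\lambda_3\sinh(b\xi+\xi_0)$, where $\xi=\alpha_1x_1+\alpha_2x_2$, $\alpha_1^2+\alpha_2^2\neq0$ and $b,\xi_0\in\mathbb{R}$. Here $\lambda_1,\lambda_2,\lambda_3$ denote real constants.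
   Context: Here $(\alpha_1,\alpha_2,\alpha_3)\in\mathbb{R}^3$ is a nonzero vector, and each $l_s$ is a smooth positive function of $\xi$ on an open interval, regarded as a function of $x=(x_1,x_2,x_3)$ on the corresponding open set of $\mathbb{R}^3$ (the $l_s$ are the coefficients $l_s=\sqrt{g(\partial_{x_s},\partial_{x_s})}$ of an orthogonal metric $g=\sum l_s^2dx_s^2$). "Any function" in b.2) means any smooth function (subject to positivity of the $l_s$). Put $\varepsilon_1=\varepsilon_3=1$, $\varepsilon_2=-1$ and $h_{ij}=l_{i,x_j}/l_j$ for $i\ne j$ (subscripts $,x_j$ are partial derivatives). The functions are a solution of Lamé's system (with Guichard condition) if for all distinct $i,j,k\in\{1,2,3\}$: $$\varepsilon_i l_i^2+\varepsilon_j l_j^2+\varepsilon_k l_k^2=0\quad(\text{i.e. } l_1^2-l_2^2+l_3^2=0),$$ $$\varepsilon_i l_{i,x_i}+\varepsilon_j h_{ji}l_j+\varepsilon_k h_{ki}l_k=0,\qquad h_{ij,x_k}-h_{ik}h_{kj}=0,$$ $$h_{ij,x_j}+h_{ji,x_i}+h_{ik}h_{jk}=0,\qquad \varepsilon_i h_{ij,x_i}+\varepsilon_j h_{ji,x_j}+\varepsilon_k h_{ki}h_{kj}=0.$$ *)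

theory Defs
  imports "HOL-Analysis.Analysis"
begin

definition smooth_on :: "real set \<Rightarrow> (real \<Rightarrow> real) \<Rightarrow> bool" where
  "smooth_on I f \<longleftrightarrow> (\<forall>n. \<forall>t\<in>I. (deriv ^^ n) f field_differentiable (at t))"

definition partial :: "3 \<Rightarrow> (real^3 \<Rightarrow> real) \<Rightarrow> real^3 \<Rightarrow> real" where
  "partial j F x = deriv (\<lambda>t. F (x + t *\<^sub>R axis j 1)) 0"

definition eps :: "3 \<Rightarrow> real" where
  "eps s = (if s = 2 then - 1 else 1)"

definition rot :: "(3 \<Rightarrow> real^3 \<Rightarrow> real) \<Rightarrow> 3 \<Rightarrow> 3 \<Rightarrow> real^3 \<Rightarrow> real" where
  "rot L i j x = partial j (L i) x / L j x"

text \<open>The index type \<^typ>\<open>3\<close> has exactly the elements 1, 2, 3 (with \<open>3 = 0\<close>).\<close>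

definition lame_guichard :: "(real^3) set \<Rightarrow> (3 \<Rightarrow> real^3 \<Rightarrow> real) \<Rightarrow> bool" where
  "lame_guichard U L \<longleftrightarrow>
    (\<forall>x\<in>U. \<forall>i j k :: 3. i \<noteq> j \<and> j \<noteq> k \<and> i \<noteq> k \<longrightarrow>
       eps i * (L i x)\<^sup>2 + eps j * (L j x)\<^sup>2 + eps k * (L k x)\<^sup>2 = 0 \<and>
       eps i * partial i (L i) x + eps j * rot L j i x * L j x + eps k * rot L k i x * L k x = 0 \<and>
       partial k (rot L i j) x - rot L i k x * rot L k j x = 0 \<and>
       partial j (rot L i j) x + partial i (rot L j i) x + rot L i k x * rot L j k x = 0 \<and>
       eps i * partial i (rot L i j) x + eps j * partial j (rot L j i) x
         + eps k * rot L k i x * rot L k j x = 0)"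

definition lame_solution_along :: "real^3 \<Rightarrow> real set \<Rightarrow> (3 \<Rightarrow> real \<Rightarrow> real) \<Rightarrow> bool" where
  "lame_solution_along \<alpha> I l \<longleftrightarrow>
     (\<forall>s. smooth_on I (l s) \<and> (\<forall>t\<in>I. l s t > 0)) \<and>
     lame_guichard {x. \<alpha> \<bullet> x \<in> I} (\<lambda>s x. l s (\<alpha> \<bullet> x))"

definition trig_triple :: "real \<Rightarrow> (real \<Rightarrow> real) \<Rightarrow> 3 \<Rightarrow> real \<Rightarrow> real" where
  "trig_triple c \<phi> s t = (if s = 1 then c * cos (\<phi> t) else if s = 2 then c else c * sin (\<phi> t))"

end

theory Submission
  imports Defs
begin

text \<open>
  Along \<open>\<xi> = \<alpha> \<bullet> x\<close> the system becomes a system of ordinary differential equations. If \<open>l p\<close> is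
  the constant coefficient and \<open>\<alpha>$p \<noteq> 0\<close>, the second derivatives of the other two coefficients
  vanish; differentiating the Guichard condition twice then forces these to be constant as well.
  So \<open>\<alpha>$p = 0\<close>, the Guichard condition parametrizes the remaining two coefficients by a
  (hyperbolic or circular) angle \<open>\<phi>\<close>, and the only surviving equation is \<open>\<phi>'' = 0\<close> with the factor
  \<open>(\<alpha>$q)\<^sup>2 + (\<alpha>$r)\<^sup>2\<close> in the hyperbolic and \<open>(\<alpha>$1)\<^sup>2 - (\<alpha>$3)\<^sup>2\<close> in the circular case.
\<close>

section \<open>Smooth functions of one variable\<close>

lemma smooth_on_diff:
  assumes "smooth_on I f" "t \<in> I"
  shows "(f has_field_derivative deriv f t) (at t)"
proof -
  have "(deriv ^^ 0) f field_differentiable (at t)"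
    using assms unfolding smooth_on_def by blast
  then show ?thesis by (simp add: DERIV_deriv_iff_field_differentiable)
qed

lemma smooth_on_deriv:
  assumes "smooth_on I f"
  shows "smooth_on I (deriv f)"
  unfolding smooth_on_def
proof (intro allI ballI)
  fix n t assume "t \<in> I"
  then have "(deriv ^^ Suc n) f field_differentiable (at t)"
    using assms unfolding smooth_on_def by blast
  then show "(deriv ^^ n) (deriv f) field_differentiable (at t)"
    by (simp add: funpow_swap1)
qed

text \<open>The derivative at a point depends only on germs, so identities known only on an open
  \<open>I\<close> may be differentiated there. This is how every algebraic relation below is
  differentiated.\<close>

lemma deriv_cong_open:
  fixes f g :: "real \<Rightarrow> real"
  assumes "open I" "t \<in> I" "\<And>s. s \<in> I \<Longrightarrow> f s = g s"
  shows "deriv f t = deriv g t"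
  using assms by (intro deriv_cong_ev refl) (auto simp: eventually_nhds)

text \<open>By induction on \<open>n\<close>, the \<open>n\<close>-th derivative of \<open>f\<close>
  agrees on \<open>I\<close> with some member of \<open>S\<close>, and every member of
  \<open>S\<close> is differentiable on \<open>I\<close>. Smoothness thus follows from one
  differentiation step inside \<open>S\<close>.\<close>

lemma smooth_on_coinduct:
  assumes "open I" "f \<in> S"
    and step: "\<And>f. f \<in> S \<Longrightarrow> \<exists>g\<in>S. \<forall>t\<in>I. (f has_field_derivative g t) (at t)"
  shows "smooth_on I f"
proof -
  \<comment> \<open>Agreement is claimed on \<open>I\<close> only, since nothing is known about
    \<open>f\<close> elsewhere; openness of \<open>I\<close> carries it to the next
    derivative.\<close>
  have iter: "\<exists>g\<in>S. \<forall>t\<in>I. (deriv ^^ n) f t = g t" for n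
  proof (induction n)
    case 0
    then show ?case using assms(2) by auto
  next
    case (Suc n)
    then obtain g where g: "g \<in> S" "\<forall>t\<in>I. (deriv ^^ n) f t = g t" by blast
    obtain h where h: "h \<in> S" "\<forall>t\<in>I. (g has_field_derivative h t) (at t)"
      using step[OF g(1)] by blast
    have "(deriv ^^ Suc n) f t = h t" if "t \<in> I" for t
    proof -
      have "deriv ((deriv ^^ n) f) t = deriv g t"
        using g(2) by (intro deriv_cong_open[OF assms(1) that]) auto
      also have "\<dots> = h t"
        using h(2) that by (simp add: DERIV_imp_deriv)
      finally show ?thesis by simp
    qed
    then show ?case using h(1) by blast
  qed
  show ?thesis
    unfolding smooth_on_def
  proof (intro allI ballI)
    fix n t assume t: "t \<in> I"
    obtain g where g: "g \<in> S" "\<forall>t\<in>I. (deriv ^^ n) f t = g t" using iter by blast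
    obtain h where h: "\<forall>t\<in>I. (g has_field_derivative h t) (at t)"
      using step[OF g(1)] by blast
    have "((deriv ^^ n) f has_field_derivative h t) (at t)"
      using has_field_derivative_transform_within_open[OF _ assms(1) t, of g "h t"] h g t by auto
    then show "(deriv ^^ n) f field_differentiable (at t)"
      by (auto simp: field_differentiable_def)
  qed
qed

text \<open>A class of functions closed under differentiation, so that coinduction applies without
  computing iterated derivatives.\<close>

inductive_set smooth_alg :: "real set \<Rightarrow> (real \<Rightarrow> real) set" for I where
  base: "smooth_on I f \<Longrightarrow> f \<in> smooth_alg I"
| const: "(\<lambda>t. c) \<in> smooth_alg I"
| add: "f \<in> smooth_alg I \<Longrightarrow> g \<in> smooth_alg I \<Longrightarrow> (\<lambda>t. f t + g t) \<in> smooth_alg I"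
| mult: "f \<in> smooth_alg I \<Longrightarrow> g \<in> smooth_alg I \<Longrightarrow> (\<lambda>t. f t * g t) \<in> smooth_alg I"
| cos: "smooth_on I f \<Longrightarrow> (\<lambda>t. cos (f t)) \<in> smooth_alg I"
| sin: "smooth_on I f \<Longrightarrow> (\<lambda>t. sin (f t)) \<in> smooth_alg I"

lemma smooth_alg_smooth:
  assumes "open I" "f \<in> smooth_alg I"
  shows "smooth_on I f"
proof (rule smooth_on_coinduct[OF assms])
  fix f assume "f \<in> smooth_alg I"
  then show "\<exists>g\<in>smooth_alg I. \<forall>t\<in>I. (f has_field_derivative g t) (at t)"
  proof induction
    case (base f)
    then show ?case
      by (auto intro!: bexI[of _ "deriv f"] smooth_on_diff smooth_alg.base smooth_on_deriv)
  next
    case (const c)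
    then show ?case
      by (auto intro!: bexI[of _ "\<lambda>t. 0"] smooth_alg.const)
  next
    case (add f g)
    then obtain f' g' where "f' \<in> smooth_alg I" "g' \<in> smooth_alg I"
      "\<forall>t\<in>I. (f has_field_derivative f' t) (at t)" "\<forall>t\<in>I. (g has_field_derivative g' t) (at t)"
      by blast
    then show ?case
      by (intro bexI[of _ "\<lambda>t. f' t + g' t"])
        (auto intro!: derivative_eq_intros smooth_alg.add)
  next
    case (mult f g)
    then obtain f' g' where "f' \<in> smooth_alg I" "g' \<in> smooth_alg I"
      "\<forall>t\<in>I. (f has_field_derivative f' t) (at t)" "\<forall>t\<in>I. (g has_field_derivative g' t) (at t)"
      by blast
    then show ?case using mult.hyps
      by (intro bexI[of _ "\<lambda>t. f' t * g t + g' t * f t"])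
        (auto intro!: derivative_eq_intros smooth_alg.add smooth_alg.mult)
  next
    case (cos f)
    \<comment> \<open>The sign is a constant factor because the class is generated by constants,
      sums and products, without a rule for negation.\<close>
    have "(\<lambda>t. (- 1) * (sin (f t) * deriv f t)) \<in> smooth_alg I"
      by (intro smooth_alg.intros smooth_on_deriv cos)
    then show ?case
      by (rule bexI[rotated]) (auto intro!: derivative_eq_intros smooth_on_diff[OF cos])
  next
    case (sin f)
    have "(\<lambda>t. cos (f t) * deriv f t) \<in> smooth_alg I"
      by (intro smooth_alg.intros smooth_on_deriv sin)
    then show ?case
      by (rule bexI[rotated]) (auto intro!: derivative_eq_intros smooth_on_diff[OF sin])
  qed
qed

text \<open>Coinduction on the smooth functions together with \<open>f\<close> itself: one step
  leads from \<open>f\<close> to \<open>g\<close>, and all further steps stay among smooth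
  functions. It serves the angle \<open>arctan (l 3 t / l 1 t)\<close>, which is not built by the
  rules of \<open>smooth_alg\<close>.\<close>

lemma smooth_on_antideriv:
  assumes "open I" "smooth_on I g" "\<And>t. t \<in> I \<Longrightarrow> (f has_field_derivative g t) (at t)"
  shows "smooth_on I f"
proof (rule smooth_on_coinduct[OF assms(1), of _ "insert f (Collect (smooth_on I))"])
  fix h assume "h \<in> insert f (Collect (smooth_on I))"
  then consider "h = f" | "smooth_on I h" by blast
  then show "\<exists>d\<in>insert f (Collect (smooth_on I)). \<forall>t\<in>I. (h has_field_derivative d t) (at t)"
  proof cases
    case 1
    then show ?thesis using assms(2,3) by (intro bexI[of _ g]) auto
  next
    case 2
    then show ?thesis by (intro bexI[of _ "deriv h"]) (auto intro: smooth_on_diff smooth_on_deriv)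
  qed
qed simp

lemma deriv_zero_imp_const:
  fixes f :: "real \<Rightarrow> real"
  assumes "is_interval I" "\<And>t. t \<in> I \<Longrightarrow> (f has_field_derivative 0) (at t)"
  obtains c where "\<And>t. t \<in> I \<Longrightarrow> f t = c"
  using has_field_derivative_zero_constant[of I f] assms
  by (metis has_field_derivative_at_within is_interval_convex)

lemma const_deriv_imp_affine:
  fixes f :: "real \<Rightarrow> real"
  assumes "is_interval I" "\<And>t. t \<in> I \<Longrightarrow> (f has_field_derivative b) (at t)"
  obtains t0 where "\<And>t. t \<in> I \<Longrightarrow> f t = b * t + t0"
proof -
  have "((\<lambda>t. f t - b * t) has_field_derivative 0) (at t)" if "t \<in> I" for t
    using assms(2)[OF that] by (auto intro!: derivative_eq_intros)
  then obtain c where "\<And>t. t \<in> I \<Longrightarrow> f t - b * t = c"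
    using deriv_zero_imp_const[OF assms(1), of "\<lambda>t. f t - b * t"] by blast
  then show ?thesis by (intro that[of c]) (simp add: algebra_simps)
qed

section \<open>Reduction to ordinary differential equations\<close>

text \<open>Chain rule along a coordinate line. \<open>F\<close> has to factor through
  \<open>\<alpha> \<bullet> y\<close> only over \<open>I\<close>, so the lemma also applies to
  \<open>rot L i j\<close>, whose formula is known only there.\<close>

lemma partial_along:
  assumes "open I" "\<alpha> \<bullet> x \<in> I" and F: "\<And>y. \<alpha> \<bullet> y \<in> I \<Longrightarrow> F y = f (\<alpha> \<bullet> y)"
    and f: "(f has_field_derivative d) (at (\<alpha> \<bullet> x))"
  shows "partial j F x = \<alpha> $ j * d"
proof -
  have a: "\<alpha> \<bullet> (x + t *\<^sub>R axis j 1) = \<alpha> \<bullet> x + t * \<alpha> $ j" for t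
    by (simp add: inner_add_right inner_axis)
  \<comment> \<open>The parameters for which the line stays over \<open>I\<close> form an open set
    containing 0, so \<open>F\<close> and \<open>f\<close> agree along the line near 0.\<close>
  have "open ((\<lambda>t. \<alpha> \<bullet> x + t * \<alpha> $ j) -` I)"
    by (intro continuous_open_vimage assms(1)) (auto intro!: continuous_intros)
  then have "deriv (\<lambda>t. F (x + t *\<^sub>R axis j 1)) 0 = deriv (\<lambda>t. f (\<alpha> \<bullet> x + t * \<alpha> $ j)) 0"
    by (rule deriv_cong_open) (use assms(2) F a in auto)
  also have "((\<lambda>t. f (\<alpha> \<bullet> x + t * \<alpha> $ j)) has_field_derivative d * (\<alpha> $ j)) (at 0)"
    by (rule DERIV_chain2[where f = f]) (use f in \<open>auto intro!: derivative_eq_intros\<close>)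
  then have "deriv (\<lambda>t. f (\<alpha> \<bullet> x + t * \<alpha> $ j)) 0 = \<alpha> $ j * d"
    by (simp add: DERIV_imp_deriv)
  finally show ?thesis by (simp add: partial_def)
qed

text \<open>The one-variable part of the rotation coefficient: \<open>h_ij\<close> equals
  \<open>\<alpha>$j * ratio l i j\<close> at \<open>\<alpha> \<bullet> x\<close>.\<close>

definition ratio :: "(3 \<Rightarrow> real \<Rightarrow> real) \<Rightarrow> 3 \<Rightarrow> 3 \<Rightarrow> real \<Rightarrow> real" where
  "ratio l i j t = deriv (l i) t / l j t"

text \<open>The components of \<open>\<alpha>\<close> produced by the chain rule are kept as factors
  rather than cancelled, since some of them vanish in each case of the classification.\<close>

definition lame_ode :: "real^3 \<Rightarrow> real set \<Rightarrow> (3 \<Rightarrow> real \<Rightarrow> real) \<Rightarrow> bool" where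
  "lame_ode \<alpha> I l \<longleftrightarrow>
    (\<forall>t\<in>I. \<forall>i j k :: 3. i \<noteq> j \<and> j \<noteq> k \<and> i \<noteq> k \<longrightarrow>
       eps i * (l i t)\<^sup>2 + eps j * (l j t)\<^sup>2 + eps k * (l k t)\<^sup>2 = 0 \<and>
       \<alpha>$i * (eps i * deriv (l i) t + eps j * ratio l j i t * l j t + eps k * ratio l k i t * l k t) = 0 \<and>
       \<alpha>$j * \<alpha>$k * (deriv (ratio l i j) t - ratio l i k t * ratio l k j t) = 0 \<and>
       (\<alpha>$j)\<^sup>2 * deriv (ratio l i j) t + (\<alpha>$i)\<^sup>2 * deriv (ratio l j i) t
         + (\<alpha>$k)\<^sup>2 * (ratio l i k t * ratio l j k t) = 0 \<and>
       \<alpha>$i * \<alpha>$j * (eps i * deriv (ratio l i j) t + eps j * deriv (ratio l j i) t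
         + eps k * (ratio l k i t * ratio l k j t)) = 0)"

lemma ratio_deriv:
  assumes "\<And>s. smooth_on I (l s)" "\<And>s t. t \<in> I \<Longrightarrow> l s t > 0" "t \<in> I"
  shows "(ratio l i j has_field_derivative deriv (ratio l i j) t) (at t)"
proof -
  have "l j t \<noteq> 0" using assms(2)[OF assms(3), of j] by simp
  then have "(\<lambda>t. deriv (l i) t / l j t) field_differentiable at t"
    using smooth_on_diff[OF smooth_on_deriv[OF assms(1)] assms(3)] smooth_on_diff[OF assms(1,3)]
    by (intro field_differentiable_divide) (auto simp: field_differentiable_def)
  then show ?thesis
    unfolding DERIV_deriv_iff_field_differentiable by (simp add: ratio_def[abs_def])
qed

text \<open>The chain rule translates the equations point by point, and
  \<open>\<alpha> \<noteq> 0\<close> makes \<open>\<alpha> \<bullet> x\<close> take every real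
  value. One direction yields the classification, the other verifies the solutions with an arbitrary
  angle.\<close>

lemma lame_guichard_along_iff:
  assumes "open I" "\<alpha> \<noteq> 0"
    and l: "\<And>s. smooth_on I (l s)" "\<And>s t. t \<in> I \<Longrightarrow> l s t > 0"
  shows "lame_guichard {x. \<alpha> \<bullet> x \<in> I} (\<lambda>s x. l s (\<alpha> \<bullet> x)) \<longleftrightarrow> lame_ode \<alpha> I l"
proof -
  define L where "L = (\<lambda>s x. l s (\<alpha> \<bullet> x))"
  have P: "partial j (L i) x = \<alpha>$j * deriv (l i) (\<alpha> \<bullet> x)" if "\<alpha> \<bullet> x \<in> I" for i j x
    by (rule partial_along[OF assms(1) that]) (auto simp: L_def smooth_on_diff[OF l(1) that])
  have R: "rot L i j x = \<alpha>$j * ratio l i j (\<alpha> \<bullet> x)" if "\<alpha> \<bullet> x \<in> I" for i j x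
    using P[OF that] by (simp add: rot_def ratio_def) (simp add: L_def)
  have D: "partial k (rot L i j) x = \<alpha>$k * (\<alpha>$j * deriv (ratio l i j) (\<alpha> \<bullet> x))"
    if "\<alpha> \<bullet> x \<in> I" for i j k x
    by (rule partial_along[OF assms(1) that, where f = "\<lambda>t. \<alpha>$j * ratio l i j t"])
      (use R in \<open>auto intro!: DERIV_cmult ratio_deriv[OF l that]\<close>)
  define E where "E t i j k \<longleftrightarrow>
       eps i * (l i t)\<^sup>2 + eps j * (l j t)\<^sup>2 + eps k * (l k t)\<^sup>2 = 0 \<and>
       \<alpha>$i * (eps i * deriv (l i) t + eps j * ratio l j i t * l j t + eps k * ratio l k i t * l k t) = 0 \<and>
       \<alpha>$j * \<alpha>$k * (deriv (ratio l i j) t - ratio l i k t * ratio l k j t) = 0 \<and>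
       (\<alpha>$j)\<^sup>2 * deriv (ratio l i j) t + (\<alpha>$i)\<^sup>2 * deriv (ratio l j i) t
         + (\<alpha>$k)\<^sup>2 * (ratio l i k t * ratio l j k t) = 0 \<and>
       \<alpha>$i * \<alpha>$j * (eps i * deriv (ratio l i j) t + eps j * deriv (ratio l j i) t
         + eps k * (ratio l k i t * ratio l k j t)) = 0" for t and i j k :: 3
  have point: "(eps i * (L i x)\<^sup>2 + eps j * (L j x)\<^sup>2 + eps k * (L k x)\<^sup>2 = 0 \<and>
       eps i * partial i (L i) x + eps j * rot L j i x * L j x + eps k * rot L k i x * L k x = 0 \<and>
       partial k (rot L i j) x - rot L i k x * rot L k j x = 0 \<and>
       partial j (rot L i j) x + partial i (rot L j i) x + rot L i k x * rot L j k x = 0 \<and>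
       eps i * partial i (rot L i j) x + eps j * partial j (rot L j i) x
         + eps k * rot L k i x * rot L k j x = 0) \<longleftrightarrow> E (\<alpha> \<bullet> x) i j k"
    if x: "\<alpha> \<bullet> x \<in> I" for x i j k
    unfolding E_def P[OF x] R[OF x] D[OF x]
    unfolding L_def
    \<comment> \<open>The conjuncts are matched one by one: in each, the two left-hand sides are
      equal as polynomial expressions.\<close>
    by (intro arg_cong2[of _ _ _ _ "(\<and>)"] arg_cong[of _ _ "\<lambda>u. u = (0::real)"])
      (simp_all add: algebra_simps power2_eq_square)
  have "lame_guichard {x. \<alpha> \<bullet> x \<in> I} L \<longleftrightarrow>
    (\<forall>x\<in>{x. \<alpha> \<bullet> x \<in> I}. \<forall>i j k. i \<noteq> j \<and> j \<noteq> k \<and> i \<noteq> k \<longrightarrow> E (\<alpha> \<bullet> x) i j k)"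
    unfolding lame_guichard_def using point by simp
  also have "\<dots> \<longleftrightarrow> (\<forall>t\<in>I. \<forall>i j k. i \<noteq> j \<and> j \<noteq> k \<and> i \<noteq> k \<longrightarrow> E t i j k)"
  proof -
    \<comment> \<open>A preimage of \<open>t\<close> on the line spanned by
      \<open>\<alpha>\<close>.\<close>
    have "\<alpha> \<bullet> ((t / (\<alpha> \<bullet> \<alpha>)) *\<^sub>R \<alpha>) = t" for t using assms(2) by simp
    then have "\<exists>x. \<alpha> \<bullet> x = t" for t by blast
    then show ?thesis by (metis mem_Collect_eq)
  qed
  also have "\<dots> \<longleftrightarrow> lame_ode \<alpha> I l"
    unfolding lame_ode_def E_def ..
  finally show ?thesis unfolding L_def .
qed

lemma eps_simps [simp]: "eps 1 = 1" "eps 2 = - 1" "eps 3 = 1"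
  by (simp_all add: eps_def)

section \<open>One constant coefficient\<close>

locale lame_along =
  fixes \<alpha> :: "real^3" and I :: "real set" and l :: "3 \<Rightarrow> real \<Rightarrow> real"
  assumes open_I: "open I" and interval_I: "is_interval I" and nonempty_I: "I \<noteq> {}"
    and alpha: "\<alpha> \<noteq> 0" and solution: "lame_solution_along \<alpha> I l"
begin

lemma smooth: "smooth_on I (l s)" and pos: "t \<in> I \<Longrightarrow> l s t > 0"
  using solution unfolding lame_solution_along_def by auto

lemma ode: "lame_ode \<alpha> I l"
proof -
  have "lame_guichard {x. \<alpha> \<bullet> x \<in> I} (\<lambda>s x. l s (\<alpha> \<bullet> x)) \<longleftrightarrow> lame_ode \<alpha> I l"
    by (rule lame_guichard_along_iff[OF open_I alpha]) (fact smooth, fact pos)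
  then show ?thesis
    using solution unfolding lame_solution_along_def by simp
qed

lemmas l_deriv = smooth_on_diff[OF smooth]
lemmas l_deriv2 = smooth_on_diff[OF smooth_on_deriv[OF smooth]]

lemma ratio_l_deriv:
  "t \<in> I \<Longrightarrow> (ratio l i j has_field_derivative deriv (ratio l i j) t) (at t)"
  by (rule ratio_deriv[where I = I]) (rule smooth, rule pos)

lemma guichard:
  assumes "i \<noteq> j" "j \<noteq> k" "i \<noteq> k" "t \<in> I"
  shows "eps i * (l i t)\<^sup>2 + eps j * (l j t)\<^sup>2 + eps k * (l k t)\<^sup>2 = 0"
  using ode assms unfolding lame_ode_def by blast

lemma curvature:
  assumes "i \<noteq> j" "j \<noteq> k" "i \<noteq> k" "t \<in> I"
  shows "(\<alpha>$j)\<^sup>2 * deriv (ratio l i j) t + (\<alpha>$i)\<^sup>2 * deriv (ratio l j i) t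
         + (\<alpha>$k)\<^sup>2 * (ratio l i k t * ratio l j k t) = 0"
  using ode assms unfolding lame_ode_def by blast

section \<open>Consequences of a constant coefficient, for any labelling of the indices\<close>

context
  fixes p q r :: 3 and c :: real
  assumes distinct: "p \<noteq> q" "q \<noteq> r" "p \<noteq> r"
    and const: "\<And>t. t \<in> I \<Longrightarrow> l p t = c"
    and nonconst: "\<not> l q constant_on I" "\<not> l r constant_on I"
begin

lemma const_pos: "c > 0"
  using nonempty_I pos[of _ p] const by fastforce

lemma guichard_const:
  assumes "t \<in> I"
  shows "eps q * (l q t)\<^sup>2 + eps r * (l r t)\<^sup>2 = - eps p * c\<^sup>2"
  using guichard[OF distinct assms] const[OF assms] by simp

lemma guichard_deriv:
  assumes "t \<in> I"
  shows "eps q * l q t * deriv (l q) t + eps r * l r t * deriv (l r) t = 0"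
proof -
  have "((\<lambda>t. eps q * (l q t)\<^sup>2 + eps r * (l r t)\<^sup>2) has_field_derivative
      2 * (eps q * l q t * deriv (l q) t + eps r * l r t * deriv (l r) t)) (at t)"
    using l_deriv[OF assms] by (auto intro!: derivative_eq_intros simp: algebra_simps)
  then have "deriv (\<lambda>t. eps q * (l q t)\<^sup>2 + eps r * (l r t)\<^sup>2) t =
      2 * (eps q * l q t * deriv (l q) t + eps r * l r t * deriv (l r) t)"
    by (rule DERIV_imp_deriv)
  moreover have "deriv (\<lambda>t. eps q * (l q t)\<^sup>2 + eps r * (l r t)\<^sup>2) t = deriv (\<lambda>t. - eps p * c\<^sup>2) t"
    by (rule deriv_cong_open[OF open_I assms guichard_const])
  ultimately show ?thesis by simp
qed

lemma deriv_const_coeff: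
  assumes "t \<in> I"
  shows "deriv (l p) t = 0"
  using deriv_cong_open[OF open_I assms, of "l p" "\<lambda>_. c"] const by simp

lemma ratio_to_const:
  assumes "t \<in> I"
  shows "deriv (ratio l i p) t = deriv (deriv (l i)) t / c"
proof -
  have "deriv (ratio l i p) t = deriv (\<lambda>t. deriv (l i) t / c) t"
    by (rule deriv_cong_open[OF open_I assms]) (simp add: ratio_def const)
  also have "\<dots> = deriv (deriv (l i)) t / c"
    using l_deriv2[OF assms] by (intro DERIV_imp_deriv DERIV_cdivide)
  finally show ?thesis .
qed

lemma ratio_of_const:
  assumes "t \<in> I"
  shows "ratio l p i t = 0" "deriv (ratio l p i) t = 0"
proof -
  show "ratio l p i t = 0" by (simp add: ratio_def deriv_const_coeff assms)
  have "deriv (ratio l p i) t = deriv (\<lambda>_. 0) t"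
    by (rule deriv_cong_open[OF open_I assms]) (simp add: ratio_def deriv_const_coeff)
  then show "deriv (ratio l p i) t = 0" by simp
qed

text \<open>Otherwise the curvature equation for the pair \<open>i\<close>, \<open>p\<close> reduces
  to \<open>(\<alpha>$p)\<^sup>2 * deriv (ratio l i p) t = 0\<close>, so both remaining coefficients
  have zero second derivative. The twice differentiated Guichard condition then forces
  \<open>deriv (l q)\<close> to vanish.\<close>

lemma alpha_const_zero: "\<alpha>$p = 0"
proof (rule ccontr)
  assume a: "\<alpha>$p \<noteq> 0"
  have second: "deriv (deriv (l i)) t = 0" if t: "t \<in> I" and i: "i = q \<or> i = r" for t i
  proof -
    obtain k where k: "p \<noteq> k" "i \<noteq> k" "i \<noteq> p" using i distinct by blast
    have "(\<alpha>$p)\<^sup>2 * deriv (ratio l i p) t = 0"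
      using curvature[OF k(3,1,2) t] ratio_of_const[OF t] by simp
    then show ?thesis using a const_pos ratio_to_const[OF t] by simp
  qed
  have "deriv (l q) t = 0" if t: "t \<in> I" for t
  proof -
    let ?u = "deriv (l q) t" and ?v = "deriv (l r) t"
    have "((\<lambda>t. eps q * l q t * deriv (l q) t + eps r * l r t * deriv (l r) t) has_field_derivative
        eps q * ?u\<^sup>2 + eps r * ?v\<^sup>2) (at t)"
      using l_deriv[OF t] l_deriv2[OF t] second[OF t]
      by (auto intro!: derivative_eq_intros simp: power2_eq_square)
    then have "deriv (\<lambda>t. eps q * l q t * deriv (l q) t + eps r * l r t * deriv (l r) t) t =
        eps q * ?u\<^sup>2 + eps r * ?v\<^sup>2"
      by (rule DERIV_imp_deriv)
    moreover have "deriv (\<lambda>t. eps q * l q t * deriv (l q) t + eps r * l r t * deriv (l r) t) t =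
        deriv (\<lambda>t. 0) t"
      by (rule deriv_cong_open[OF open_I t guichard_deriv])
    ultimately have 2: "eps q * ?u\<^sup>2 + eps r * ?v\<^sup>2 = 0" by simp
    \<comment> \<open>By \<open>guichard_const\<close> the left-hand side is
      \<open>- eps p * c\<^sup>2 * eps q * ?u\<^sup>2\<close>. Trading the \<open>q\<close> terms
      for \<open>r\<close> terms by the first and second derivatives of the Guichard condition makes
      everything cancel, whatever the signs, so \<open>?u\<close> is zero.\<close>
    have "eps q * ?u\<^sup>2 * (eps q * (l q t)\<^sup>2 + eps r * (l r t)\<^sup>2) =
        (eps q * l q t * ?u)\<^sup>2 + eps r * (l r t)\<^sup>2 * (eps q * ?u\<^sup>2)"
      by (simp add: algebra_simps power2_eq_square)
    also have "\<dots> = (eps r * l r t * ?v)\<^sup>2 + eps r * (l r t)\<^sup>2 * (- (eps r * ?v\<^sup>2))"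
    proof -
      have "eps q * l q t * ?u = - (eps r * l r t * ?v)" "eps q * ?u\<^sup>2 = - (eps r * ?v\<^sup>2)"
        using guichard_deriv[OF t] 2 by linarith+
      then show ?thesis by simp
    qed
    also have "\<dots> = 0" by (simp add: algebra_simps power2_eq_square)
    finally show ?thesis
      using guichard_const[OF t] const_pos by (auto simp: eps_def split: if_splits)
  qed
  then have "(l q has_field_derivative 0) (at t)" if "t \<in> I" for t
    using l_deriv[OF that, of q] that by simp
  then obtain d where "\<And>t. t \<in> I \<Longrightarrow> l q t = d"
    using deriv_zero_imp_const[OF interval_I] by blast
  then show False using nonconst(1) unfolding constant_on_def by blast
qed

text \<open>In the curvature equation for the pair \<open>q\<close>, \<open>r\<close> the quadratic
  term carries \<open>(\<alpha>$p)\<^sup>2 = 0\<close>. What is left determines the angle.\<close>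

lemma curvature_const:
  assumes "t \<in> I"
  shows "(\<alpha>$r)\<^sup>2 * deriv (ratio l q r) t + (\<alpha>$q)\<^sup>2 * deriv (ratio l r q) t = 0"
  using curvature[OF distinct(2) distinct(3)[symmetric] distinct(1)[symmetric] assms]
    alpha_const_zero by simp

lemma alpha_rest: "(\<alpha>$q)\<^sup>2 + (\<alpha>$r)\<^sup>2 \<noteq> 0"
proof
  assume "(\<alpha>$q)\<^sup>2 + (\<alpha>$r)\<^sup>2 = 0"
  then have "\<alpha>$q = 0" "\<alpha>$r = 0" by (simp_all add: sum_power2_eq_zero_iff)
  moreover have "i = p \<or> i = q \<or> i = r" for i
    using distinct exhaust_3[of i] exhaust_3[of p] exhaust_3[of q] exhaust_3[of r] by metis
  ultimately have "\<alpha>$i = 0" for i using alpha_const_zero by metis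
  then show False using alpha by (simp add: vec_eq_iff)
qed

section \<open>The hyperbolic cases\<close>

text \<open>For these signs the differentiated Guichard condition says that the two ratios coincide,
  so the curvature equation is a nonzero sum of squares times the derivative of their common value.
  That value is therefore a constant \<open>b\<close>, and it is the derivative of the angle
  \<open>arsinh (l r t / c)\<close>.\<close>

lemma hyperbolic:
  assumes e: "eps p = 1" "eps q = - 1" "eps r = 1"
  shows "\<exists>b t0. \<forall>t\<in>I. l q t = c * cosh (b * t + t0) \<and> l r t = c * sinh (b * t + t0)"
proof -
  have sym: "ratio l q r t = ratio l r q t" if "t \<in> I" for t
    using guichard_deriv[OF that] e pos[OF that, of q] pos[OF that, of r]
    by (simp add: ratio_def field_simps)
  have "deriv (ratio l q r) t = deriv (ratio l r q) t" if "t \<in> I" for t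
    by (rule deriv_cong_open[OF open_I that sym])
  then have prod: "((\<alpha>$q)\<^sup>2 + (\<alpha>$r)\<^sup>2) * deriv (ratio l r q) t = 0" if "t \<in> I" for t
    using curvature_const[OF that] that by (simp add: algebra_simps)
  have "deriv (ratio l r q) t = 0" if "t \<in> I" for t
    using prod[OF that] alpha_rest by (simp only: mult_eq_0_iff simp_thms)
  then have "(ratio l r q has_field_derivative 0) (at t)" if "t \<in> I" for t
    using ratio_l_deriv[OF that, of r q] that by simp
  then obtain b where b: "\<And>t. t \<in> I \<Longrightarrow> ratio l r q t = b"
    using deriv_zero_imp_const[OF interval_I] by blast
  \<comment> \<open>This square root is both the denominator in the derivative of
    \<open>arsinh\<close> and the \<open>cosh\<close> of the angle, so it is used twice.\<close>
  have root: "c * sqrt ((l r t / c)\<^sup>2 + 1) = l q t" if "t \<in> I" for t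
  proof -
    have "(l r t)\<^sup>2 + c\<^sup>2 = (l q t)\<^sup>2"
      using guichard_const[OF that] e by simp
    then have "(l r t / c)\<^sup>2 + 1 = (l q t / c)\<^sup>2"
      using const_pos by (simp add: power_divide divide_add_eq_iff)
    then show ?thesis
      using const_pos pos[OF that, of q] by simp
  qed
  have "((\<lambda>t. arsinh (l r t / c)) has_field_derivative b) (at t)" if "t \<in> I" for t
  proof -
    have "((\<lambda>t. arsinh (l r t / c)) has_field_derivative
        1 / sqrt ((l r t / c)\<^sup>2 + 1) * (deriv (l r) t / c)) (at t)"
      by (rule DERIV_chain2[OF arsinh_real_has_field_derivative])
        (rule DERIV_cdivide[OF l_deriv[OF that]])
    moreover have "1 / sqrt ((l r t / c)\<^sup>2 + 1) * (deriv (l r) t / c) = b"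
      using root[OF that] b[OF that] by (simp add: ratio_def mult.commute)
    ultimately show ?thesis by simp
  qed
  then obtain t0 where t0: "\<And>t. t \<in> I \<Longrightarrow> arsinh (l r t / c) = b * t + t0"
    using const_deriv_imp_affine[OF interval_I, of "\<lambda>t. arsinh (l r t / c)" b] by blast
  have "l r t = c * sinh (b * t + t0)" "l q t = c * cosh (b * t + t0)" if "t \<in> I" for t
  proof -
    have "sinh (b * t + t0) = l r t / c" using t0[OF that] sinh_arsinh_real by metis
    then show "l r t = c * sinh (b * t + t0)" using const_pos by simp
    have "cosh (b * t + t0) = sqrt ((l r t / c)\<^sup>2 + 1)"
      using t0[OF that] cosh_arsinh_real by metis
    then show "l q t = c * cosh (b * t + t0)" using root[OF that] by simp
  qed
  then show ?thesis by blast
qed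

end

section \<open>The circular case\<close>

text \<open>Now the ratios are opposite, so the curvature equation has the factor
  \<open>(\<alpha>$1)\<^sup>2 - (\<alpha>$3)\<^sup>2\<close>, which may vanish. Since
  \<open>l 1\<close> and \<open>l 3\<close> are positive, \<open>arctan\<close> of their quotient is
  a valid angle on all of \<open>I\<close>; its derivative is \<open>ratio l 3 1\<close>.\<close>

lemma circular:
  assumes const: "\<And>t. t \<in> I \<Longrightarrow> l 2 t = c"
    and nonconst: "\<not> l 1 constant_on I" "\<not> l 3 constant_on I"
  defines "\<phi> \<equiv> \<lambda>t. arctan (l 3 t / l 1 t)"
  shows "t \<in> I \<Longrightarrow> l s t = trig_triple c \<phi> s t" "smooth_on I \<phi>"
    "(\<alpha>$1)\<^sup>2 \<noteq> (\<alpha>$3)\<^sup>2 \<Longrightarrow> \<exists>b t0. \<forall>t\<in>I. \<phi> t = b * t + t0"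
proof -
  have distinct: "(2::3) \<noteq> 1" "(1::3) \<noteq> 3" "(2::3) \<noteq> 3" by simp_all
  note ctx = distinct const nonconst
  have c: "c > 0" by (rule const_pos[OF ctx])
  have sq: "(l 1 t)\<^sup>2 + (l 3 t)\<^sup>2 = c\<^sup>2" if "t \<in> I" for t
    using guichard_const[OF ctx that] by simp
  \<comment> \<open>The reciprocal of this root is the cosine of
    \<open>arctan (l 3 t / l 1 t)\<close>.\<close>
  have root: "sqrt (1 + (l 3 t / l 1 t)\<^sup>2) = c / l 1 t" if "t \<in> I" for t
  proof -
    have "1 + (l 3 t / l 1 t)\<^sup>2 = (c / l 1 t)\<^sup>2"
      using pos[OF that, of 1] unfolding power_divide sq[OF that, symmetric]
      by (simp add: add_divide_distrib)
    then show ?thesis using c pos[OF that, of 1] by simp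
  qed
  have triple: "l s t = trig_triple c \<phi> s t" if "t \<in> I" for s t
  proof -
    have "l 1 t = c * cos (\<phi> t)" "l 3 t = c * sin (\<phi> t)"
      using root[OF that] c pos[OF that, of 1] by (simp_all add: \<phi>_def cos_arctan sin_arctan)
    then show ?thesis
      using exhaust_3[of s] const[OF that] by (auto simp: trig_triple_def)
  qed
  then show "t \<in> I \<Longrightarrow> l s t = trig_triple c \<phi> s t" .
  have anti: "ratio l 1 3 t = - ratio l 3 1 t" if "t \<in> I" for t
    using guichard_deriv[OF ctx that] pos[OF that, of 1] pos[OF that, of 3]
    by (simp add: ratio_def field_simps)
  have phi': "(\<phi> has_field_derivative ratio l 3 1 t) (at t)" if "t \<in> I" for t
  proof -
    have p: "l 1 t > 0" "l 3 t > 0" using pos[OF that] by auto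
    have "(\<phi> has_field_derivative inverse (1 + (l 3 t / l 1 t)\<^sup>2) *
        ((deriv (l 3) t * l 1 t - l 3 t * deriv (l 1) t) / (l 1 t * l 1 t))) (at t)"
      unfolding \<phi>_def
      by (rule DERIV_chain2[OF DERIV_arctan], rule DERIV_divide) (use l_deriv[OF that] p in auto)
    moreover have "inverse (1 + (l 3 t / l 1 t)\<^sup>2) *
        ((deriv (l 3) t * l 1 t - l 3 t * deriv (l 1) t) / (l 1 t * l 1 t)) = ratio l 3 1 t"
    proof -
      have d1: "deriv (l 1) t = - (l 3 t * ratio l 3 1 t)"
        using anti[OF that] p by (simp add: ratio_def field_simps)
      have d3: "deriv (l 3) t = l 1 t * ratio l 3 1 t"
        using p by (simp add: ratio_def)
      have "(l 1 t)\<^sup>2 + (l 3 t)\<^sup>2 \<noteq> 0" using p by (simp add: sum_power2_eq_zero_iff)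
      then show ?thesis
        unfolding d1 d3 using p by (simp add: divide_simps) (simp add: algebra_simps power2_eq_square)
    qed
    ultimately show ?thesis by simp
  qed
  show "smooth_on I \<phi>"
  proof (rule smooth_on_antideriv[OF open_I])
    \<comment> \<open>The derivative of the angle has denominator
      \<open>(l 1 t)\<^sup>2 + (l 3 t)\<^sup>2\<close>, which is the constant
      \<open>c\<^sup>2\<close>. Written this way it needs no division by functions and lies in
      \<open>smooth_alg\<close>.\<close>
    have "(\<lambda>t. (1 / c\<^sup>2) * (deriv (l 3) t * l 1 t + (- 1) * (l 3 t * deriv (l 1) t))) \<in> smooth_alg I"
      by (intro smooth_alg.intros smooth_on_deriv smooth)
    then show "smooth_on I (\<lambda>t. (1 / c\<^sup>2) * (deriv (l 3) t * l 1 t + (- 1) * (l 3 t * deriv (l 1) t)))"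
      by (rule smooth_alg_smooth[OF open_I])
    show "(\<phi> has_field_derivative
        (1 / c\<^sup>2) * (deriv (l 3) t * l 1 t + (- 1) * (l 3 t * deriv (l 1) t))) (at t)" if "t \<in> I" for t
    proof -
      have p: "l 1 t > 0" "l 3 t > 0" using pos[OF that] by auto
      have d1: "deriv (l 1) t = - (l 3 t * ratio l 3 1 t)"
        using anti[OF that] p by (simp add: ratio_def field_simps)
      have d3: "deriv (l 3) t = l 1 t * ratio l 3 1 t"
        using p by (simp add: ratio_def)
      have "deriv (l 3) t * l 1 t + (- 1) * (l 3 t * deriv (l 1) t) = c\<^sup>2 * ratio l 3 1 t"
        unfolding d1 d3 sq[OF that, symmetric] by (simp add: algebra_simps power2_eq_square)
      then show ?thesis using phi'[OF that] c by simp
    qed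
  qed
  show "\<exists>b t0. \<forall>t\<in>I. \<phi> t = b * t + t0" if ne: "(\<alpha>$1)\<^sup>2 \<noteq> (\<alpha>$3)\<^sup>2"
  proof -
    have "(ratio l 3 1 has_field_derivative 0) (at t)" if t: "t \<in> I" for t
    proof -
      have "deriv (ratio l 1 3) t = deriv (\<lambda>t. - ratio l 3 1 t) t"
        by (rule deriv_cong_open[OF open_I t anti])
      also have "\<dots> = - deriv (ratio l 3 1) t"
        by (intro DERIV_imp_deriv DERIV_minus ratio_l_deriv[OF t])
      finally have "((\<alpha>$1)\<^sup>2 - (\<alpha>$3)\<^sup>2) * deriv (ratio l 3 1) t = 0"
        using curvature_const[OF ctx t] by (simp add: algebra_simps)
      then show ?thesis
        using ratio_l_deriv[OF t, of 3 1] ne by simp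
    qed
    then obtain b where "\<And>t. t \<in> I \<Longrightarrow> ratio l 3 1 t = b"
      using deriv_zero_imp_const[OF interval_I] by blast
    then have "(\<phi> has_field_derivative b) (at t)" if "t \<in> I" for t
      using phi'[OF that] that by simp
    then show ?thesis using const_deriv_imp_affine[OF interval_I, of \<phi> b] by metis
  qed
qed

end

section \<open>Arbitrary angles give solutions when the two squares agree\<close>

text \<open>This makes precise that the angle in b.2 is any function. The only equation that could
  restrict \<open>\<psi>\<close> is the curvature equation for the pair 1, 3, which reads
  \<open>((\<alpha>$1)\<^sup>2 - (\<alpha>$3)\<^sup>2) * deriv (deriv \<psi>) t = 0\<close>.\<close>

lemma trig_triple_solution:
  assumes "open I" "\<alpha> \<noteq> 0" and a: "\<alpha>$2 = 0" "(\<alpha>$1)\<^sup>2 = (\<alpha>$3)\<^sup>2"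
    and psi: "smooth_on I \<psi>" and pos: "\<And>s t. t \<in> I \<Longrightarrow> trig_triple c \<psi> s t > 0"
  shows "lame_solution_along \<alpha> I (trig_triple c \<psi>)"
proof -
  let ?l = "trig_triple c \<psi>"
  have l: "?l 1 = (\<lambda>t. c * cos (\<psi> t))" "?l 2 = (\<lambda>t. c)" "?l 3 = (\<lambda>t. c * sin (\<psi> t))"
    by (simp_all add: trig_triple_def fun_eq_iff)
  have "(\<lambda>t. c * cos (\<psi> t)) \<in> smooth_alg I" "(\<lambda>t. c) \<in> smooth_alg I"
    "(\<lambda>t. c * sin (\<psi> t)) \<in> smooth_alg I"
    by (intro smooth_alg.intros psi)+
  then have smooth: "smooth_on I (?l s)" for s
    using exhaust_3[of s] l smooth_alg_smooth[OF assms(1)] by auto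
  have d: "deriv (?l 1) t = - c * sin (\<psi> t) * deriv \<psi> t" "deriv (?l 2) t = 0"
      "deriv (?l 3) t = c * cos (\<psi> t) * deriv \<psi> t" if "t \<in> I" for t
    unfolding l using smooth_on_diff[OF psi that]
    by (auto intro!: DERIV_imp_deriv derivative_eq_intros)
  \<comment> \<open>Positivity of the triple supplies the nonzero denominators of the ratios,
    including \<open>c\<close> through the index 2.\<close>
  have nz: "c \<noteq> 0" "cos (\<psi> t) \<noteq> 0" "sin (\<psi> t) \<noteq> 0" if "t \<in> I" for t
    using pos[OF that, of 1] pos[OF that, of 2] pos[OF that, of 3] by (auto simp: l)
  have r: "ratio ?l 1 3 t = - deriv \<psi> t" "ratio ?l 3 1 t = deriv \<psi> t"
      "ratio ?l 2 i t = 0" "ratio ?l 1 2 t = - sin (\<psi> t) * deriv \<psi> t"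
      "ratio ?l 3 2 t = cos (\<psi> t) * deriv \<psi> t" if "t \<in> I" for t i
    unfolding ratio_def d[OF that] using nz[OF that] by (simp_all add: l)
  have dr: "deriv (ratio ?l 1 3) t = - deriv (deriv \<psi>) t"
      "deriv (ratio ?l 3 1) t = deriv (deriv \<psi>) t"
      "deriv (ratio ?l 2 j) t = 0" if "t \<in> I" for t j
  proof -
    have "deriv (ratio ?l 1 3) t = deriv (\<lambda>t. - deriv \<psi> t) t"
      by (rule deriv_cong_open[OF assms(1) that r(1)])
    also have "\<dots> = - deriv (deriv \<psi>) t"
      by (intro DERIV_imp_deriv DERIV_minus smooth_on_diff[OF smooth_on_deriv[OF psi] that])
    finally show "deriv (ratio ?l 1 3) t = - deriv (deriv \<psi>) t" .
    show "deriv (ratio ?l 3 1) t = deriv (deriv \<psi>) t"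
      by (rule deriv_cong_open[OF assms(1) that r(2)])
    have "deriv (ratio ?l 2 j) t = deriv (\<lambda>t. 0) t"
      by (rule deriv_cong_open[OF assms(1) that r(3)])
    then show "deriv (ratio ?l 2 j) t = 0" by simp
  qed
  have lt: "?l 1 t = c * cos (\<psi> t)" "?l 2 t = c" "?l 3 t = c * sin (\<psi> t)" for t
    by (simp_all add: l)
  have pyth: "(c * cos x)\<^sup>2 + (c * sin x)\<^sup>2 = c\<^sup>2" for x
    by (simp add: power_mult_distrib flip: distrib_left)
  have "lame_ode \<alpha> I ?l"
    unfolding lame_ode_def
  proof (intro ballI allI impI)
    fix t i j k assume t: "t \<in> I" and ijk: "i \<noteq> j \<and> j \<noteq> k \<and> i \<noteq> (k::3)"
    from exhaust_3[of i] exhaust_3[of j] exhaust_3[of k] ijk consider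
      "i = 1" "j = 2" "k = 3" | "i = 1" "j = 3" "k = 2" | "i = 2" "j = 1" "k = 3"
      | "i = 2" "j = 3" "k = 1" | "i = 3" "j = 1" "k = 2" | "i = 3" "j = 2" "k = 1"
      by metis
    then show "eps i * (?l i t)\<^sup>2 + eps j * (?l j t)\<^sup>2 + eps k * (?l k t)\<^sup>2 = 0 \<and>
       \<alpha>$i * (eps i * deriv (?l i) t + eps j * ratio ?l j i t * ?l j t + eps k * ratio ?l k i t * ?l k t) = 0 \<and>
       \<alpha>$j * \<alpha>$k * (deriv (ratio ?l i j) t - ratio ?l i k t * ratio ?l k j t) = 0 \<and>
       (\<alpha>$j)\<^sup>2 * deriv (ratio ?l i j) t + (\<alpha>$i)\<^sup>2 * deriv (ratio ?l j i) t
         + (\<alpha>$k)\<^sup>2 * (ratio ?l i k t * ratio ?l j k t) = 0 \<and>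
       \<alpha>$i * \<alpha>$j * (eps i * deriv (ratio ?l i j) t + eps j * deriv (ratio ?l j i) t
         + eps k * (ratio ?l k i t * ratio ?l k j t)) = 0"
      by cases (use pyth[of "\<psi> t"] in
        \<open>simp_all add: d[OF t] r[OF t] dr[OF t] a lt algebra_simps power_mult_distrib\<close>)
  qed
  moreover have "lame_guichard {x. \<alpha> \<bullet> x \<in> I} (\<lambda>s x. ?l s (\<alpha> \<bullet> x)) \<longleftrightarrow> lame_ode \<alpha> I ?l"
    by (rule lame_guichard_along_iff[OF assms(1,2)]) (fact smooth, fact pos)
  ultimately show ?thesis
    unfolding lame_solution_along_def using smooth pos by simp
qed

section \<open>The classification, by the index of the constant coefficient\<close>

theorem theorem4:
  fixes \<alpha> :: "real^3" and I :: "real set" and l :: "3 \<Rightarrow> real \<Rightarrow> real"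
  assumes "open I" and "is_interval I" and "I \<noteq> {}"
    and "\<alpha> \<noteq> 0"
    and "lame_solution_along \<alpha> I l"
    and "\<exists>!s. l s constant_on I"
  shows
    "(\<alpha>$1 = 0 \<and> (\<alpha>$2)\<^sup>2 + (\<alpha>$3)\<^sup>2 \<noteq> 0 \<and>
      (\<exists>c b t0. \<forall>t\<in>I. l 1 t = c \<and> l 2 t = c * cosh (b * t + t0) \<and> l 3 t = c * sinh (b * t + t0)))
   \<or> (\<alpha>$2 = 0 \<and> (\<alpha>$1)\<^sup>2 + (\<alpha>$3)\<^sup>2 \<noteq> 0 \<and>
      (\<exists>c \<phi>. (\<forall>s. \<forall>t\<in>I. l s t = trig_triple c \<phi> s t) \<and>
        ((\<alpha>$1)\<^sup>2 \<noteq> (\<alpha>$3)\<^sup>2 \<and> (\<exists>b t0. \<forall>t\<in>I. \<phi> t = b * t + t0) \<or>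
         (\<alpha>$1)\<^sup>2 = (\<alpha>$3)\<^sup>2 \<and> smooth_on I \<phi> \<and>
           (\<forall>\<psi>. smooth_on I \<psi> \<and> (\<forall>s. \<forall>t\<in>I. trig_triple c \<psi> s t > 0)
              \<longrightarrow> lame_solution_along \<alpha> I (trig_triple c \<psi>)))))
   \<or> (\<alpha>$3 = 0 \<and> (\<alpha>$1)\<^sup>2 + (\<alpha>$2)\<^sup>2 \<noteq> 0 \<and>
      (\<exists>c b t0. \<forall>t\<in>I. l 3 t = c \<and> l 2 t = c * cosh (b * t + t0) \<and> l 1 t = c * sinh (b * t + t0)))"
proof -
  interpret lame_along \<alpha> I l by unfold_locales (use assms in auto)
  obtain p where p: "l p constant_on I" and uniq: "\<And>s. l s constant_on I \<Longrightarrow> s = p"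
    using assms(6) by blast
  obtain c where c: "\<And>t. t \<in> I \<Longrightarrow> l p t = c" using p unfolding constant_on_def by blast
  have nc: "\<not> l s constant_on I" if "s \<noteq> p" for s using uniq that by blast
  have dist: "(1::3) \<noteq> 2" "(2::3) \<noteq> 3" "(1::3) \<noteq> 3" "(2::3) \<noteq> 1" "(3::3) \<noteq> 2" "(3::3) \<noteq> 1"
    by simp_all
  consider "p = 1" | "p = 2" | "p = 3" using exhaust_3 by blast
  then show ?thesis
  proof cases
    case 1
    \<comment> \<open>The labelling is \<open>p = 1\<close>, \<open>q = 2\<close>,
      \<open>r = 3\<close>: \<open>q\<close> must be the index of negative sign, which becomes the
      \<open>cosh\<close> coefficient.\<close>
    note ctx = dist(1-3) c[unfolded 1] nc[unfolded 1, OF dist(4)] nc[unfolded 1, OF dist(6)]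
    obtain b t0 where h: "\<forall>t\<in>I. l 2 t = c * cosh (b * t + t0) \<and> l 3 t = c * sinh (b * t + t0)"
      using hyperbolic[OF ctx eps_simps] by auto
    show ?thesis
      by (intro disjI1 conjI exI[of _ c] exI[of _ b] exI[of _ t0])
        (use alpha_const_zero[OF ctx] alpha_rest[OF ctx] h ctx(4) in auto)
  next
    case 2
    note ctx = c[unfolded 2] nc[unfolded 2, OF dist(1)] nc[unfolded 2, OF dist(5)]
    have \<alpha>: "\<alpha>$2 = 0" "(\<alpha>$1)\<^sup>2 + (\<alpha>$3)\<^sup>2 \<noteq> 0"
      by (rule alpha_const_zero[OF dist(4,3,2) ctx], assumption)
         (rule alpha_rest[OF dist(4,3,2) ctx], assumption)
    let ?\<phi> = "\<lambda>t. arctan (l 3 t / l 1 t)"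
    have "(\<forall>s. \<forall>t\<in>I. l s t = trig_triple c ?\<phi> s t) \<and>
        ((\<alpha>$1)\<^sup>2 \<noteq> (\<alpha>$3)\<^sup>2 \<and> (\<exists>b t0. \<forall>t\<in>I. ?\<phi> t = b * t + t0) \<or>
         (\<alpha>$1)\<^sup>2 = (\<alpha>$3)\<^sup>2 \<and> smooth_on I ?\<phi> \<and>
           (\<forall>\<psi>. smooth_on I \<psi> \<and> (\<forall>s. \<forall>t\<in>I. trig_triple c \<psi> s t > 0)
              \<longrightarrow> lame_solution_along \<alpha> I (trig_triple c \<psi>)))"
      using circular[OF ctx] trig_triple_solution[OF assms(1,4) \<alpha>(1)] by blast
    then show ?thesis using \<alpha> by (intro disjI2 disjI1) blast
  next
    case 3
    \<comment> \<open>The same argument with 1 and 3 exchanged: \<open>p = 3\<close>,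
      \<open>q = 2\<close>, \<open>r = 1\<close>.\<close>
    note ctx = dist(5,4,6) c[unfolded 3] nc[unfolded 3, OF dist(2)] nc[unfolded 3, OF dist(3)]
    obtain b t0 where h: "\<forall>t\<in>I. l 2 t = c * cosh (b * t + t0) \<and> l 1 t = c * sinh (b * t + t0)"
      using hyperbolic[OF ctx eps_simps(3,2,1)] by auto
    show ?thesis
      by (intro disjI2 conjI exI[of _ c] exI[of _ b] exI[of _ t0])
        (use alpha_const_zero[OF ctx] alpha_rest[OF ctx] h ctx(4) in auto)
  qed
qed

end
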